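(* Let $L$ be a unimodular lattice of rank $n$ with $n\not\equiv 6,7 \pmod 8$ such that $\mathrm{Exc}\,L\neq\emptyset$. Then the isometry group $\mathrm{O}(L)$ acts transitively on $\mathrm{Exc}\,L$.
   Context: A lattice is an integral Euclidean lattice $L$ (positive definite, $\mathbb{Z}$-valued symmetric bilinear form $x\cdot y$); $L^\sharp$ is its dual and $L$ is unimodular if $L=L^\sharp$. A characteristic vector of $L$ is $\xi\in L^\sharp$ with $x\cdot\xi\equiv x\cdot x \pmod 2$ for all $x\in L$. $\mathrm{Exc}\,L$ denotes the set of characteristic vectors of $L$ of norm $\xi\cdot\xi<8$. $\mathrm{O}(L)$ is the group of isometries of $L$. *)

theory Defs
  imports
    "HOL-Analysis.Analysis"
    "HOL-Library.Real_Mod"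
    "HOL-Number_Theory.Cong"
    "HOL-Algebra.Group_Action"
begin

definition lattice_basis :: "'a::euclidean_space set \<Rightarrow> 'a set \<Rightarrow> bool" where
  "lattice_basis B L \<longleftrightarrow>
     finite B \<and> independent B \<and>
     L = {\<Sum>b\<in>B. of_int (c b) *\<^sub>R b | c :: 'a \<Rightarrow> int. True}"

text \<open>
  A lattice is realised inside a Euclidean space, the bilinear form being the inner product.
  It need not span the ambient space, so \<open>n\<close> is its own rank (possibly \<open>0\<close>),
  not the ambient dimension.
\<close>

definition integral_lattice :: "nat \<Rightarrow> 'a::euclidean_space set \<Rightarrow> bool" where
  "integral_lattice n L \<longleftrightarrow>
     (\<exists>B. lattice_basis B L \<and> card B = n) \<and> (\<forall>x\<in>L. \<forall>y\<in>L. x \<bullet> y \<in> \<int>)"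

text \<open>The dual is taken in the real span of \<open>L\<close>, that is, in \<open>L \<otimes> \<real>\<close>.\<close>

definition dual_lattice :: "'a::euclidean_space set \<Rightarrow> 'a set" where
  "dual_lattice L = {y \<in> span L. \<forall>x\<in>L. x \<bullet> y \<in> \<int>}"

definition unimodular :: "'a::euclidean_space set \<Rightarrow> bool" where
  "unimodular L \<longleftrightarrow> dual_lattice L = L"

definition characteristic_vectors :: "'a::euclidean_space set \<Rightarrow> 'a set" where
  "characteristic_vectors L =
     {\<xi> \<in> dual_lattice L. \<forall>x\<in>L. [x \<bullet> \<xi> = x \<bullet> x] (rmod 2)}"

text \<open>The norm of a vector is \<open>\<xi> \<bullet> \<xi>\<close>, the square of its Euclidean length.\<close>

definition Exc :: "'a::euclidean_space set \<Rightarrow> 'a set" where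
  "Exc L = {\<xi> \<in> characteristic_vectors L. \<xi> \<bullet> \<xi> < 8}"

text \<open>
  Isometries of \<open>L\<close> are additive bijections of \<open>L\<close> that preserve the form. They form a group under
  composition of maps on \<open>L\<close>, inherited from the group of all bijections of \<open>L\<close>.
\<close>

definition isometry_group :: "'a::euclidean_space set \<Rightarrow> ('a \<Rightarrow> 'a) monoid" where
  "isometry_group L = (BijGroup L)
     \<lparr>carrier := {f \<in> Bij L. (\<forall>x\<in>L. \<forall>y\<in>L. f (x + y) = f x + f y) \<and>
                            (\<forall>x\<in>L. \<forall>y\<in>L. f x \<bullet> f y = x \<bullet> y)}\<rparr>"

text \<open>
  An isometry is only specified on \<open>L\<close>, so its restriction to \<open>Exc L\<close> is the natural action only
  when \<open>Exc L \<subseteq> L\<close>. This holds for unimodular \<open>L\<close>, where \<open>Exc L \<subseteq> dual_lattice L = L\<close>.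
\<close>

definition Exc_action :: "'a::euclidean_space set \<Rightarrow> ('a \<Rightarrow> 'a) \<Rightarrow> 'a \<Rightarrow> 'a" where
  "Exc_action L f = restrict f (Exc L)"

end

theory Submission
  imports Defs
begin

text \<open>
  Two exceptional vectors \<open>\<xi>\<close>, \<open>\<eta>\<close> are congruent modulo \<open>2 L\<close>, so \<open>v = (\<xi> - \<eta>) / 2\<close> and
  \<open>u = (\<xi> + \<eta>) / 2\<close> lie in \<open>L\<close>. By van der Blij's congruence \<open>\<xi> \<bullet> \<xi> \<equiv> n (mod 8)\<close>, both vectors have norm
  \<open>n mod 8 \<le> 5\<close>; hence \<open>u\<close> and \<open>v\<close> are orthogonal with \<open>u \<bullet> u + v \<bullet> v \<le> 5\<close>, and one of them has norm at
  most \<open>2\<close>. The reflection in \<open>v\<close>, or minus the reflection in \<open>u\<close>, then preserves \<open>L\<close> and maps \<open>\<xi>\<close> to \<open>\<eta>\<close>.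

  The congruence is obtained by evaluating in two ways the Gauss sum of the discriminant form of
  an even sublattice \<open>M\<close> of \<open>L\<close> with an orthogonal basis: as a product of classical quadratic Gauss sums
  it has argument \<open>n \<pi> / 4\<close>, and as a sum over the discriminant group, in which \<open>L\<close> is self-orthogonal,
  it has argument \<open>\<xi> \<bullet> \<xi> \<pi> / 4\<close>.
\<close>

section \<open>Quadratic Gauss sums\<close>

text \<open>For even \<open>a\<close> this is the Gauss sum of the discriminant form of a rank one
  lattice whose generator has norm \<open>a\<close>, hence \<open>pi\<close> in place of
  \<open>2 * pi\<close>. Evenness of \<open>a\<close> makes the summand periodic modulo
  \<open>a\<close>.\<close>

definition gauss_sum :: "nat \<Rightarrow> complex" where
  "gauss_sum a = (\<Sum>k<a. cis (pi * (real k)\<^sup>2 / real a))"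

section \<open>Periodicity, chord lengths and sums of roots of unity\<close>

lemma cis_pi_cong:
  assumes "x = y + 2 * of_int n"
  shows "cis (pi * x) = cis (pi * y)"
proof -
  have "cis (pi * x) = cis (pi * y) * cis (2 * pi * of_int n)"
    by (simp add: assms cis_mult algebra_simps)
  then show ?thesis by simp
qed

lemma norm_cis_diff: "norm (cis a - cis b) = 2 * \<bar>sin ((a - b) / 2)\<bar>"
proof -
  have "cis a - cis b = cis b * (cis (a - b) - 1)"
    by (simp add: algebra_simps cis_mult)
  then have "norm (cis a - cis b) = norm (exp (\<i> * of_real (a - b)) - 1)"
    by (simp add: norm_mult cis_conv_exp)
  then show ?thesis
    using dist_exp_i_1[of "a - b"] by simp
qed

lemma norm_cis_diff_le: "norm (cis a - cis b) \<le> \<bar>a - b\<bar>"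
  using abs_sin_x_le_abs_x[of "(a - b) / 2"] by (simp add: norm_cis_diff)

text \<open>The chord has length \<open>2 * sin (t / 2)\<close>, and the Taylor bound
  \<open>sin x \<ge> x - x ^ 3 / 6\<close> gives \<open>x / 3\<close> as long as
  \<open>x \<le> 2\<close>; \<open>pi < 4\<close> puts \<open>t / 2\<close> in that range.\<close>

lemma norm_cis_diff_ge:
  assumes "0 \<le> t" "t \<le> pi"
  shows "norm (cis t - 1) \<ge> t / 3"
proof -
  define x where "x = t / 2"
  have x: "0 \<le> x" "x \<le> 2"
    using assms pi_less_4 by (auto simp: x_def)
  have "\<bar>sin x - (\<Sum>m<3. sin_coeff m * x ^ m)\<bar> \<le> inverse (fact 3) * \<bar>x\<bar> ^ 3"
    by (rule Maclaurin_sin_bound)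
  then have "\<bar>sin x - x\<bar> \<le> x ^ 3 / 6"
    using x by (simp add: numeral_eq_Suc sin_coeff_def)
  moreover have "x ^ 3 \<le> 4 * x"
  proof -
    have "x\<^sup>2 \<le> 2\<^sup>2" using x by (intro power_mono) auto
    then have "x\<^sup>2 * x \<le> 4 * x" using x by (intro mult_right_mono) auto
    then show ?thesis by (simp add: power2_eq_square power3_eq_cube)
  qed
  ultimately have "sin x \<ge> x / 3" by linarith
  then show ?thesis
    using norm_cis_diff[of t 0] by (simp add: x_def)
qed

lemma cis_sum: "finite A \<Longrightarrow> cis (\<Sum>i\<in>A. f i) = (\<Prod>i\<in>A. cis (f i))"
  by (induction A rule: finite_induct) (auto simp: cis_mult[symmetric])

lemma sum_roots_of_unity:
  assumes "t > 0"
  shows "(\<Sum>y<t. cis (2 * pi * real x / real t) ^ y) = (if t dvd x then of_nat t else 0)"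
proof (cases "t dvd x")
  case True
  then obtain q where "x = t * q" by (elim dvdE)
  then have "cis (2 * pi * real x / real t) = 1"
    using assms cis_multiple_2pi[of "real q"] by (simp add: mult.assoc)
  then show ?thesis using True by simp
next
  case False
  define w where "w = cis (2 * pi * real x / real t)"
  have "w \<noteq> 1"
  proof
    assume "w = 1"
    then obtain n where "2 * pi * real x / real t = of_int n * (2 * pi)"
      by (auto simp: w_def cis_eq_1_iff)
    then have "real x = of_int n * real t"
      using assms by (simp add: field_simps)
    then have "int x = n * int t"
      by (metis of_int_eq_iff of_int_mult of_int_of_nat_eq)
    then have "int t dvd int x" by simp
    then show False using False by (simp add: int_dvd_int_iff)
  qed
  moreover have "w ^ t = 1"
    using assms cis_multiple_2pi[of "real x"] unfolding w_def Complex.DeMoivre by (simp add: mult.assoc)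
  ultimately have "(\<Sum>y<t. w ^ y) = 0"
    by (simp add: geometric_sum)
  then show ?thesis using False by (simp add: w_def)
qed

text \<open>Write the index as \<open>x + y * (a * t)\<close> with \<open>x < a * t\<close> and
  \<open>y < t\<close>. The sum over \<open>y\<close> runs over powers of a \<open>t\<close>-th root
  of unity and vanishes unless \<open>t\<close> divides \<open>x\<close>; the surviving
  \<open>x = z * t\<close> reproduce the summands of \<open>gauss_sum a\<close>, each
  \<open>t\<close> times.\<close>

lemma gauss_sum_mult_square:
  assumes "even a" "a > 0" "t > 0"
  shows "gauss_sum (a * t\<^sup>2) = of_nat t * gauss_sum a"
proof -
  define N where "N = a * t\<^sup>2"
  define f where "f k = cis (pi * (real k)\<^sup>2 / real N)" for k
  have [simp]: "real a \<noteq> 0" "real t \<noteq> 0" using assms by auto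
  have split: "f (x + y * (a * t)) = f x * cis (2 * pi * real x / real t) ^ y" for x y
  proof -
    obtain b where b: "a = 2 * b" using assms by (elim evenE)
    have "b > 0" using assms b by simp
    \<comment> \<open>The part quadratic in \<open>y\<close> is \<open>a * y\<^sup>2\<close>, an
      even integer because \<open>a\<close> is even, so it does not affect the phase.\<close>
    have "(real (x + y * (a * t)))\<^sup>2 / real N
       = ((real x)\<^sup>2 / real N + 2 * real x * real y / real t) + 2 * of_int (int (b * y\<^sup>2))"
      using \<open>b > 0\<close> assms(3) by (simp add: N_def field_simps power2_eq_square b)
    from cis_pi_cong[OF this] show ?thesis
      by (simp add: f_def Complex.DeMoivre cis_mult algebra_simps)
  qed
  have block: "(\<Sum>k\<in>{y * (a * t)..<y * (a * t) + a * t}. f k) = (\<Sum>x<a * t. f (x + y * (a * t)))" for y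
    by (rule sum.reindex_bij_witness[of _ "\<lambda>x. x + y * (a * t)" "\<lambda>k. k - y * (a * t)"]) auto
  have "gauss_sum N = (\<Sum>k<t * (a * t). f k)"
    by (simp add: gauss_sum_def f_def N_def power2_eq_square mult_ac)
  also have "\<dots> = (\<Sum>y<t. \<Sum>k\<in>{y * (a * t)..<y * (a * t) + a * t}. f k)"
    by (simp add: sum.nat_group)
  also have "\<dots> = (\<Sum>y<t. \<Sum>x<a * t. f (x + y * (a * t)))"
    by (simp only: block)
  also have "\<dots> = (\<Sum>x<a * t. \<Sum>y<t. f x * cis (2 * pi * real x / real t) ^ y)"
    by (subst sum.swap) (simp add: split)
  also have "\<dots> = (\<Sum>x<a * t. if t dvd x then of_nat t * f x else 0)"
    unfolding sum_distrib_left[symmetric] sum_roots_of_unity[OF assms(3)]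
    by (intro sum.cong) auto
  also have "\<dots> = (\<Sum>x\<in>{x. x < a * t \<and> t dvd x}. of_nat t * f x)"
    by (simp add: sum.inter_filter[symmetric])
  also have "\<dots> = (\<Sum>z<a. of_nat t * f (z * t))"
    using assms by (intro sum.reindex_bij_witness[of _ "\<lambda>z. z * t" "\<lambda>x. x div t"])
      (auto simp: less_mult_imp_div_less)
  also have "\<dots> = (\<Sum>z<a. of_nat t * cis (pi * (real z)\<^sup>2 / real a))"
    by (intro sum.cong refl) (simp add: f_def N_def power_mult_distrib)
  finally show ?thesis
    by (simp add: N_def gauss_sum_def sum_distrib_left)
qed

text \<open>
  Summation by parts: with \<open>d k\<close> as in the proof, consecutive terms satisfy
  \<open>f (Suc k) - f k = f k * d k\<close>, and \<open>1 / d k\<close> varies slowly because \<open>norm (d k)\<close> is at least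
  of order \<open>k / N\<close>. The condition on \<open>m\<close> keeps the phase of \<open>d k + 1\<close> within \<open>[0, pi]\<close>.
\<close>

lemma gauss_tail_bound:
  assumes "0 < K" "K \<le> m" "2 * m + 1 \<le> N"
  shows "norm (\<Sum>k=K..<m. cis (pi * (real k)\<^sup>2 / real N)) \<le> 3 * real N / real K"
proof -
  define f where "f k = cis (pi * (real k)\<^sup>2 / real N)" for k
  define d where "d k = cis (pi * (2 * real k + 1) / real N) - 1" for k
  define g where "g k = 1 / d k" for k
  have N: "real N > 0" using assms by simp
  have step: "f (Suc k) - f k = f k * d k" for k
    using N by (simp add: f_def d_def algebra_simps cis_mult power2_eq_square add_divide_distrib)
  have d_ge: "norm (d k) \<ge> 2 * real k / real N" if "k \<le> m" for k
  proof -
    have "2 * real k + 1 \<le> real N"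
      using that assms by linarith
    then have "pi * (2 * real k + 1) / real N \<le> pi"
      using N mult_left_mono[of "2 * real k + 1" "real N" pi] by (simp add: divide_le_eq)
    then have "norm (d k) \<ge> pi * (2 * real k + 1) / real N / 3"
      using norm_cis_diff_ge[of "pi * (2 * real k + 1) / real N"] N by (simp add: d_def)
    moreover have "pi * (2 * real k + 1) \<ge> 3 * (2 * real k)"
      using pi_gt3 by (intro mult_mono) auto
    ultimately show ?thesis using N by (simp add: field_simps)
  qed
  have d_pos: "norm (d k) > 0" if "0 < k" "k \<le> m" for k
  proof -
    have "2 * real k / real N > 0" using that N by simp
    then show ?thesis using d_ge[OF that(2)] by linarith
  qed
  have g_le: "norm (g k) \<le> real N / (2 * real k)" if "0 < k" "k \<le> m" for k
    using d_ge[OF that(2)] d_pos[OF that] that N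
    by (simp add: g_def norm_divide field_simps)
  have dd: "norm (d k - d (Suc k)) \<le> 8 / real N" for k
  proof -
    have "norm (d k - d (Suc k)) \<le> \<bar>pi * (2 * real k + 1) / real N - pi * (2 * real (Suc k) + 1) / real N\<bar>"
      unfolding d_def using norm_cis_diff_le by simp
    also have "\<dots> = 2 * pi / real N"
      using N by (simp add: field_simps)
    also have "\<dots> \<le> 8 / real N"
      using pi_less_4 by (intro divide_right_mono) auto
    finally show ?thesis .
  qed
  have gg: "norm (g (Suc k) - g k) \<le> 2 * real N * (1 / real k - 1 / real (Suc k))"
    if "0 < k" "Suc k \<le> m" for k
  proof -
    have nz: "d k \<noteq> 0" "d (Suc k) \<noteq> 0" using d_pos[of k] d_pos[of "Suc k"] that by auto
    have "g (Suc k) - g k = (d k - d (Suc k)) / (d k * d (Suc k))"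
      using nz by (simp add: g_def field_simps)
    then have "norm (g (Suc k) - g k) = norm (d k - d (Suc k)) / (norm (d k) * norm (d (Suc k)))"
      by (simp add: norm_divide norm_mult)
    also have "\<dots> \<le> (8 / real N) / ((2 * real k / real N) * (2 * real (Suc k) / real N))"
      using that N by (intro frac_le dd mult_mono d_ge) auto
    also have "\<dots> = 2 * real N * (1 / real k - 1 / real (Suc k))"
    proof -
      have "1 / real k - 1 / real (Suc k) = 1 / (real k * real (Suc k))"
        using that by (simp add: field_simps)
      then show ?thesis using that N by (simp del: of_nat_Suc)
    qed
    finally show ?thesis .
  qed
  \<comment> \<open>The boundary terms of the summation by parts are split off. Since
    \<open>f\<close> has modulus 1, what remains is a sum of differences of \<open>g\<close>, and
    their bounds \<open>gg\<close> telescope.\<close>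
  have "m' \<le> m \<Longrightarrow> norm ((\<Sum>k=K..<m'. f k) - (f m' * g m' - f K * g K))
      \<le> 2 * real N * (1 / real K - 1 / real m')" if "K \<le> m'" for m'
    using that
  proof (induction m' rule: dec_induct)
    case base
    show ?case by simp
  next
    case (step k)
    have k: "0 < k" using step assms by simp
    have nz: "d k \<noteq> 0" using d_pos[of k] k step by auto
    have "f k = (f (Suc k) - f k) * g k"
      using nz by (simp add: g_def \<open>\<And>k. f (Suc k) - f k = f k * d k\<close>)
    also have "\<dots> = f (Suc k) * g (Suc k) - f k * g k - f (Suc k) * (g (Suc k) - g k)"
      by (simp add: algebra_simps)
    finally have fk: "f k = \<dots>" .
    have "(\<Sum>k=K..<Suc k. f k) - (f (Suc k) * g (Suc k) - f K * g K)
        = ((\<Sum>k=K..<k. f k) - (f k * g k - f K * g K)) - f (Suc k) * (g (Suc k) - g k)"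
      using step.hyps by (subst sum.atLeastLessThan_Suc, simp, subst fk) (simp add: algebra_simps)
    also have "norm \<dots> \<le> norm ((\<Sum>k=K..<k. f k) - (f k * g k - f K * g K)) + norm (f (Suc k) * (g (Suc k) - g k))"
      by (rule norm_triangle_ineq4)
    also have "\<dots> = norm ((\<Sum>k=K..<k. f k) - (f k * g k - f K * g K)) + norm (g (Suc k) - g k)"
      by (simp add: norm_mult f_def)
    also have "\<dots> \<le> 2 * real N * (1 / real K - 1 / real k)
        + 2 * real N * (1 / real k - 1 / real (Suc k))"
      using step k by (intro add_mono gg step.IH) auto
    finally show ?case by (simp add: algebra_simps)
  qed
  from this[of m] have 1: "norm ((\<Sum>k=K..<m. f k) - (f m * g m - f K * g K))
      \<le> 2 * real N * (1 / real K - 1 / real m)"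
    using assms by simp
  have 2: "norm (f m * g m - f K * g K) \<le> real N / (2 * real m) + real N / (2 * real K)"
    using norm_triangle_ineq4[of "f m * g m" "f K * g K"] g_le[of m] g_le[of K] assms
    by (simp add: norm_mult f_def)
  have "norm (\<Sum>k=K..<m. f k) \<le> 2 * real N * (1 / real K - 1 / real m)
      + (real N / (2 * real m) + real N / (2 * real K))"
    using norm_triangle_ineq[of "(\<Sum>k=K..<m. f k) - (f m * g m - f K * g K)"
        "f m * g m - f K * g K"] 1 2 by simp
  also have "\<dots> = (5 / 2) * (real N / real K) - (3 / 2) * (real N / real m)"
    by (simp add: algebra_simps)
  also have "\<dots> \<le> 3 * (real N / real K)"
  proof -
    have "0 \<le> real N / real K" "0 \<le> real N / real m" by simp_all
    then show ?thesis by linarith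
  qed
  finally show ?thesis by (simp add: f_def)
qed

text \<open>For even \<open>N\<close> the reflection \<open>k \<mapsto> N - k\<close> preserves the
  summand, so the whole sum is twice its first half up to bounded terms; from \<open>K\<close> on
  the half sum is controlled by \<open>gauss_tail_bound\<close>.\<close>

lemma gauss_sum_truncate:
  assumes "even N" "0 < K" "2 * K + 2 \<le> N"
  shows "norm (gauss_sum N - 2 * (\<Sum>k<K. cis (pi * (real k)\<^sup>2 / real N))) \<le> 6 * real N / real K + 4"
proof -
  define f where "f k = cis (pi * (real k)\<^sup>2 / real N)" for k
  \<comment> \<open>The midpoint is \<open>Suc h\<close>. The tail bound requires
    \<open>2 * m + 1 \<le> N\<close> and so is applied only up to \<open>m = h\<close>; the terms at
    \<open>h\<close> and \<open>Suc h\<close>, together with the unpaired term at 0, give the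
    constant 4.\<close>
  have "N = 2 * Suc (N div 2 - 1)" using assms by presburger
  then obtain h where h: "N = 2 * Suc h" by blast
  have sym: "f (N - k) = f k" if "k \<le> N" for k
  proof -
    have "(real (N - k))\<^sup>2 / real N = (real k)\<^sup>2 / real N + 2 * of_int (int (Suc h) - int k)"
      using that by (simp add: of_nat_diff h field_simps power2_eq_square)
    from cis_pi_cong[OF this] show ?thesis by (simp add: f_def)
  qed
  have "gauss_sum N = (\<Sum>k<Suc h. f k) + (\<Sum>k=Suc h..<N. f k)"
    unfolding gauss_sum_def f_def
    by (subst sum.atLeastLessThan_concat[of 0 "Suc h" N, symmetric, unfolded atLeast0LessThan])
      (auto simp: h atLeast0LessThan)
  also have "(\<Sum>k=Suc h..<N. f k) = (\<Sum>k=1..<Suc (Suc h). f k)"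
    by (intro sum.reindex_bij_witness[of _ "\<lambda>k. N - k" "\<lambda>k. N - k"]) (auto simp: h sym[unfolded h, simplified])
  also have "\<dots> = (\<Sum>k<Suc h. f k) + f (Suc h) - 1"
    by (simp add: atLeast0LessThan[symmetric] sum.atLeast_Suc_lessThan[of 0] f_def)
  finally have "gauss_sum N = 2 * (\<Sum>k<Suc h. f k) + f (Suc h) - 1"
    by (simp add: algebra_simps)
  also have "(\<Sum>k<Suc h. f k) = (\<Sum>k<K. f k) + (\<Sum>k=K..<h. f k) + f h"
    using assms sum.atLeastLessThan_concat[of 0 K h f] by (simp add: h atLeast0LessThan)
  finally have "gauss_sum N - 2 * (\<Sum>k<K. f k) = 2 * (\<Sum>k=K..<h. f k) + (2 * f h + (f (Suc h) - 1))"
    by (simp add: algebra_simps)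
  also have "norm \<dots> \<le> norm (2 * (\<Sum>k=K..<h. f k)) + (norm (2 * f h) + (norm (f (Suc h)) + norm (1::complex)))"
    by (intro order_trans[OF norm_triangle_ineq] add_left_mono order_trans[OF norm_triangle_ineq4]) auto
  also have "\<dots> \<le> 2 * (3 * real N / real K) + (2 + (1 + 1))"
    using gauss_tail_bound[of K h N] assms h unfolding f_def norm_mult
    by (intro add_mono mult_mono) (simp_all del: of_nat_Suc)
  finally show ?thesis by (simp add: f_def)
qed

text \<open>On \<open>{0..C}\<close> the integrand has Lipschitz constant \<open>2 * pi * C\<close>,
  so each cell of the left Riemann sum costs at most \<open>2 * pi * C * h\<^sup>2\<close>, and
  there are at most \<open>C / h\<close> cells. The rest from \<open>K * h\<close> to
  \<open>C\<close> has length at most \<open>h\<close> and an integrand of modulus 1.\<close>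

lemma riemann_sum_cis_square:
  fixes C h :: real and K :: nat
  assumes "0 < C" "0 < h" "real K * h \<le> C" "C \<le> real (Suc K) * h"
  shows "norm (h * (\<Sum>k<K. cis (pi * (real k * h)\<^sup>2)) - integral {0..C} (\<lambda>x. cis (pi * x\<^sup>2)))
    \<le> (2 * pi * C\<^sup>2 + 1) * h"
proof -
  define \<phi> where "\<phi> x = cis (pi * x\<^sup>2)" for x :: real
  define F where "F u = integral {0..u} \<phi>" for u
  have cont: "continuous_on {0..C} \<phi>"
    unfolding \<phi>_def by (intro continuous_intros)
  have F': "(F has_vector_derivative \<phi> x) (at x within {0..C})" if "x \<in> {0..C}" for x
    unfolding F_def by (rule integral_has_vector_derivative[OF cont that])
  have lip: "norm (\<phi> x - \<phi> y) \<le> 2 * pi * C * \<bar>x - y\<bar>" if "x \<in> {0..C}" "y \<in> {0..C}" for x y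
  proof -
    have "norm (\<phi> x - \<phi> y) \<le> \<bar>pi * x\<^sup>2 - pi * y\<^sup>2\<bar>"
      unfolding \<phi>_def by (rule norm_cis_diff_le)
    also have "\<dots> = pi * (x + y) * \<bar>x - y\<bar>"
      using that by (simp add: power2_eq_square abs_mult[symmetric] right_diff_distrib[symmetric]
          square_diff_square_factored) (simp add: abs_mult)
    also have "\<dots> \<le> 2 * pi * C * \<bar>x - y\<bar>"
      using that by (intro mult_right_mono) (auto simp: mult.assoc)
    finally show ?thesis .
  qed
  have piece: "norm (F v - F u - (v - u) *\<^sub>R \<phi> u) \<le> (v - u) * (2 * pi * C * (v - u))"
    if "0 \<le> u" "u \<le> v" "v \<le> C" for u v
  proof -
    have sub: "{u..v} \<subseteq> {0..C}" using that by auto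
    have "norm (F v - F u - (v - u) *\<^sub>R \<phi> u) \<le> norm (v - u) * (2 * pi * C * (v - u))"
    proof (rule vector_differentiable_bound_linearization[where S = "{u..v}" and f' = \<phi>])
      fix x assume x: "x \<in> {u..v}"
      show "(F has_vector_derivative \<phi> x) (at x within {u..v})"
        using F' x sub by (blast intro: has_vector_derivative_within_subset)
      have "norm (\<phi> x - \<phi> u) \<le> 2 * pi * C * \<bar>x - u\<bar>"
        using lip[of x u] x that by simp
      also have "\<dots> \<le> 2 * pi * C * (v - u)"
        using x assms by (intro mult_left_mono) auto
      finally show "norm (\<phi> x - \<phi> u) \<le> 2 * pi * C * (v - u)" .
    qed (use that in \<open>auto simp: closed_segment_eq_real_ivl\<close>)
    then show ?thesis using that by simp
  qed
  have "real m * h \<le> C \<Longrightarrow>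
    norm (h * (\<Sum>k<m. \<phi> (real k * h)) - F (real m * h)) \<le> real m * (2 * pi * C * h\<^sup>2)" for m
  proof (induction m)
    case 0
    show ?case by (simp add: F_def)
  next
    case (Suc m)
    have le: "real m * h \<le> C" using Suc.prems assms by (simp add: algebra_simps)
    have "real (Suc m) * h - real m * h = h" by (simp add: algebra_simps)
    then have pc: "norm (F (real (Suc m) * h) - F (real m * h) - h *\<^sub>R \<phi> (real m * h)) \<le> h * (2 * pi * C * h)"
      using piece[of "real m * h" "real (Suc m) * h"] Suc.prems assms(2) by simp
    have "h * (\<Sum>k<Suc m. \<phi> (real k * h)) - F (real (Suc m) * h)
      = (h * (\<Sum>k<m. \<phi> (real k * h)) - F (real m * h))
        - (F (real (Suc m) * h) - F (real m * h) - h *\<^sub>R \<phi> (real m * h))"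
      by (simp add: algebra_simps scaleR_conv_of_real)
    also have "norm \<dots> \<le> real m * (2 * pi * C * h\<^sup>2) + h * (2 * pi * C * h)"
      by (rule order_trans[OF norm_triangle_ineq4 add_mono[OF Suc.IH[OF le] pc]])
    finally show ?case by (simp add: algebra_simps power2_eq_square)
  qed
  from this[of K] have 1: "norm (h * (\<Sum>k<K. \<phi> (real k * h)) - F (real K * h))
      \<le> real K * h * (2 * pi * C * h)"
    using assms by (simp add: power2_eq_square algebra_simps)
  have "real K * h * (2 * pi * C * h) \<le> C * (2 * pi * C * h)"
    using assms by (intro mult_right_mono) auto
  with 1 have 1: "norm (h * (\<Sum>k<K. \<phi> (real k * h)) - F (real K * h)) \<le> 2 * pi * C\<^sup>2 * h"
    by (simp add: power2_eq_square algebra_simps)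
  have "norm (F C - F (real K * h)) \<le> 1 * norm (C - real K * h)"
  proof (rule differentiable_bound[where S = "{0..C}" and f' = "\<lambda>x t. t *\<^sub>R \<phi> x"])
    fix x assume x: "x \<in> {0..C}"
    show "(F has_derivative (\<lambda>t. t *\<^sub>R \<phi> x)) (at x within {0..C})"
      using F'[OF x] by (simp add: has_vector_derivative_def)
    show "onorm (\<lambda>t. t *\<^sub>R \<phi> x) \<le> 1"
      by (rule onorm_le) (simp add: \<phi>_def)
  qed (use assms in auto)
  also have "\<dots> \<le> h" using assms by (simp add: algebra_simps)
  finally have 2: "norm (F C - F (real K * h)) \<le> h" .
  have "norm (h * (\<Sum>k<K. \<phi> (real k * h)) - F C) \<le> 2 * pi * C\<^sup>2 * h + h"
    using norm_triangle_ineq4[of "h * (\<Sum>k<K. \<phi> (real k * h)) - F (real K * h)"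
        "F C - F (real K * h)"] 1 2 by simp
  then show ?thesis by (simp add: \<phi>_def[abs_def] F_def algebra_simps)
qed

text \<open>The substitution \<open>x = k / sqrt N\<close> makes the truncated sum a Riemann sum of
  mesh \<open>1 / sqrt N\<close> on \<open>{0..C}\<close>. The discarded tail causes the error
  \<open>12 / C\<close>, which does not shrink with \<open>N\<close>.\<close>

lemma gauss_sum_near_fresnel:
  fixes C :: real
  assumes "1 \<le> C" "even N" "sqrt (real N) \<ge> 2 * C + 2"
  shows "norm (gauss_sum N / sqrt (real N) - 2 * integral {0..C} (\<lambda>x. cis (pi * x\<^sup>2)))
    \<le> 12 / C + (4 * pi * C\<^sup>2 + 6) / sqrt (real N)"
proof -
  define s where "s = sqrt (real N)"
  define K where "K = nat \<lfloor>C * s\<rfloor>"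
  define I where "I = integral {0..C} (\<lambda>x. cis (pi * x\<^sup>2))"
  define T where "T = (\<Sum>k<K. cis (pi * (real k)\<^sup>2 / real N))"
  have s: "s \<ge> 2 * C + 2" using assms by (simp add: s_def)
  with assms have "s > 0" by linarith
  note s = s this
  have s2: "real N = s * s" by (simp add: s_def)
  have Cs: "C * s \<ge> 4"
    using s assms mult_mono[of 1 C 4 s] by simp
  have K: "real K \<le> C * s" "C * s < real K + 1"
    using Cs by (auto simp: K_def)
  \<comment> \<open>As \<open>C * s \<ge> 4\<close>, rounding down loses at most half; this turns
    the 6 of \<open>gauss_sum_truncate\<close> into 12.\<close>
  have K_half: "real K \<ge> C * s / 2" using K Cs by linarith
  then have "K > 0" using Cs by (intro Nat.gr0I) auto
  have "2 * real K + 2 \<le> (2 * C + 2) * s"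
    using K s assms by (simp add: algebra_simps)
  also have "\<dots> \<le> s * s" using s by (intro mult_right_mono) auto
  finally have "2 * K + 2 \<le> N" by (simp add: s2[symmetric])
  then have 1: "norm (gauss_sum N - 2 * T) \<le> 6 * real N / real K + 4"
    unfolding T_def using assms \<open>K > 0\<close> by (intro gauss_sum_truncate)
  also have "6 * real N / real K \<le> 6 * real N / (C * s / 2)"
    using K_half Cs s2 s by (intro divide_left_mono mult_pos_pos) auto
  also have "\<dots> = 12 / C * s" using s assms by (simp add: s2)
  finally have 1: "norm (gauss_sum N - 2 * T) \<le> 12 / C * s + 4" by simp
  have "gauss_sum N / s - 2 * I = (gauss_sum N - 2 * T) / s + 2 * ((1 / s) * T - I)"
    using s by (simp add: field_simps)
  also have "norm \<dots> \<le> norm (gauss_sum N - 2 * T) / s + 2 * norm ((1 / s) * T - I)"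
  proof -
    have "norm ((gauss_sum N - 2 * T) / s) = norm (gauss_sum N - 2 * T) / s"
      using s by (simp add: norm_divide)
    moreover have "norm (2 * ((1 / s) * T - I)) = 2 * norm ((1 / s) * T - I)"
      by (simp only: norm_mult norm_numeral)
    ultimately show ?thesis
      using norm_triangle_ineq[of "(gauss_sum N - 2 * T) / s" "2 * ((1 / s) * T - I)"] by linarith
  qed
  also have "norm ((1 / s) * T - I) \<le> (2 * pi * C\<^sup>2 + 1) * (1 / s)"
  proof -
    have "T = (\<Sum>k<K. cis (pi * (real k * (1 / s))\<^sup>2))"
      unfolding T_def by (intro sum.cong refl) (simp add: s2 power_divide power2_eq_square)
    then show ?thesis
      using riemann_sum_cis_square[of C "1 / s" K] s K assms by (simp add: I_def field_simps)
  qed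
  also have "norm (gauss_sum N - 2 * T) / s \<le> (12 / C * s + 4) / s"
    using 1 s by (intro divide_right_mono) auto
  finally show ?thesis
    using s by (simp add: s_def[symmetric] I_def add_divide_distrib algebra_simps)
qed

text \<open>
  Replacing \<open>a\<close> by \<open>a * t\<^sup>2\<close> does not change \<open>gauss_sum a / sqrt a\<close>, while for large \<open>t\<close> this quotient is
  within \<open>13 / C\<close> of a Fresnel integral that does not depend on \<open>a\<close>. Hence the quotient is the
  same for all even \<open>a\<close>, and \<open>a = 2\<close> gives its value without evaluating the integral.
\<close>

lemma gauss_sum_eq:
  assumes "even a" "a > 0"
  shows "gauss_sum a = sqrt (real a) * cis (pi / 4)"
proof -
  define u where "u n = gauss_sum n / sqrt (real n)" for n
  have near: "norm (u b - 2 * integral {0..real C} (\<lambda>x. cis (pi * x\<^sup>2))) \<le> 13 / real C"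
    if b: "even b" "b > 0" and C: "C \<ge> 1" for b C
  proof -
    \<comment> \<open>Chosen so that \<open>t / C\<close> dominates
      \<open>4 * pi * C\<^sup>2 + 6\<close>: the second error term is then at most
      \<open>1 / C\<close>, for a total of \<open>13 / C\<close>.\<close>
    define t where "t = C * (4 * nat \<lceil>pi\<rceil> * C\<^sup>2 + 6)"
    have t: "t > 0" using C by (simp add: t_def)
    have st: "sqrt (real (b * t\<^sup>2)) = sqrt (real b) * real t"
      by (simp add: real_sqrt_mult)
    have "u (b * t\<^sup>2) = u b"
      unfolding u_def st gauss_sum_mult_square[OF b t] using t by simp
    have "1 \<le> sqrt (real b)" using b by simp
    then have tle: "real t \<le> sqrt (real b) * real t"
      using mult_right_mono[of 1 "sqrt (real b)" "real t"] by simp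
    have "2 * C + 2 \<le> t"
    proof -
      have "C * 6 \<le> t" unfolding t_def by (intro mult_left_mono) auto
      then show ?thesis using C by simp
    qed
    then have "2 * real C + 2 \<le> real t" by linarith
    then have "2 * real C + 2 \<le> sqrt (real (b * t\<^sup>2))"
      using tle unfolding st by linarith
    then have "norm (u (b * t\<^sup>2) - 2 * integral {0..real C} (\<lambda>x. cis (pi * x\<^sup>2)))
        \<le> 12 / real C + (4 * pi * (real C)\<^sup>2 + 6) / sqrt (real (b * t\<^sup>2))"
      unfolding u_def using b C by (intro gauss_sum_near_fresnel) auto
    also have "(4 * pi * (real C)\<^sup>2 + 6) / sqrt (real (b * t\<^sup>2)) \<le> (real t / real C) / real t"
    proof (rule frac_le)
      have "pi \<le> real (nat \<lceil>pi\<rceil>)" by linarith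
      then have "4 * pi * (real C)\<^sup>2 + 6 \<le> 4 * real (nat \<lceil>pi\<rceil>) * (real C)\<^sup>2 + 6"
        by (intro add_right_mono mult_right_mono) auto
      then show "4 * pi * (real C)\<^sup>2 + 6 \<le> real t / real C"
        using C by (simp add: t_def)
      show "real t \<le> sqrt (real (b * t\<^sup>2))"
        using tle unfolding st .
    qed (use t in auto)
    also have "\<dots> = 1 / real C" using t by simp
    finally show ?thesis
      using \<open>u (b * t\<^sup>2) = u b\<close> by (simp add: add_divide_distrib[symmetric])
  qed
  have "u a = u 2"
  proof (rule ccontr)
    assume "u a \<noteq> u 2"
    then have pos: "norm (u a - u 2) > 0" by simp
    obtain C :: nat where C: "C > 26 / norm (u a - u 2)"
      using reals_Archimedean2 by blast
    moreover have "26 / norm (u a - u 2) > 0" using pos by simp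
    ultimately have "real C > 0" by linarith
    then have C1: "C \<ge> 1" by simp
    let ?I = "2 * integral {0..real C} (\<lambda>x. cis (pi * x\<^sup>2))"
    have "norm (u a - u 2) \<le> norm (u a - ?I) + norm (u 2 - ?I)"
      using norm_triangle_ineq4[of "u a - ?I" "u 2 - ?I"] by simp
    also have "\<dots> \<le> 13 / real C + 13 / real C"
      using near[OF assms C1] near[of 2 C] C1 by (intro add_mono) auto
    finally show False
      using C pos \<open>real C > 0\<close> by (simp add: field_simps)
  qed
  also have "u 2 = cis (pi / 4)"
  proof -
    have "gauss_sum 2 = 1 + \<i>"
      by (simp add: gauss_sum_def numeral_2_eq_2)
    moreover have "sqrt 2 * cis (pi / 4) = 1 + \<i>"
      by (simp add: complex_eq_iff cos_45 sin_45)
    ultimately show ?thesis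
      by (simp add: u_def divide_eq_eq mult.commute)
  qed
  finally show ?thesis
    using assms by (simp add: u_def field_simps)
qed

section \<open>Even orthogonal frames and van der Blij's congruence\<close>

locale zmodule =
  fixes L :: "'a::euclidean_space set"
  assumes zero: "0 \<in> L" and diff: "x \<in> L \<Longrightarrow> y \<in> L \<Longrightarrow> x - y \<in> L"
begin

lemma uminus: "x \<in> L \<Longrightarrow> - x \<in> L"
  using diff[OF zero] by simp

lemma add: "x \<in> L \<Longrightarrow> y \<in> L \<Longrightarrow> x + y \<in> L"
  using diff[of x "- y"] uminus by simp

lemma scale_nat: "x \<in> L \<Longrightarrow> of_nat n *\<^sub>R x \<in> L"
  by (induction n) (auto simp: zero scaleR_left_distrib intro: add)

lemma scale_int: "x \<in> L \<Longrightarrow> of_int n *\<^sub>R x \<in> L"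
  using scale_nat[of x "nat \<bar>n\<bar>"] uminus[OF scale_nat[of x "nat \<bar>n\<bar>"]]
  by (cases "n \<ge> 0") auto

lemma scale_Ints: "x \<in> L \<Longrightarrow> c \<in> \<int> \<Longrightarrow> c *\<^sub>R x \<in> L"
  using scale_int by (auto elim!: Ints_cases)

lemma sum: "(\<And>i. i \<in> A \<Longrightarrow> f i \<in> L) \<Longrightarrow> (\<Sum>i\<in>A. f i) \<in> L"
  by (induction A rule: infinite_finite_induct) (auto simp: zero intro: add)

end

lemma lattice_mem_iff:
  assumes "lattice_basis C L"
  shows "x \<in> L \<longleftrightarrow> (\<exists>c. x = (\<Sum>b\<in>C. of_int (c b) *\<^sub>R b))"
  using assms unfolding lattice_basis_def by auto

lemma zmodule_lattice:
  assumes "lattice_basis C L"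
  shows "zmodule L"
proof
  show "0 \<in> L"
    unfolding lattice_mem_iff[OF assms] by (intro exI[of _ "\<lambda>_. 0"]) simp
  fix x y assume "x \<in> L" "y \<in> L"
  then obtain c d where "x = (\<Sum>b\<in>C. of_int (c b) *\<^sub>R b)" "y = (\<Sum>b\<in>C. of_int (d b) *\<^sub>R b)"
    unfolding lattice_mem_iff[OF assms] by blast
  then show "x - y \<in> L"
    unfolding lattice_mem_iff[OF assms]
    by (intro exI[of _ "\<lambda>b. c b - d b"]) (simp add: sum_subtractf scaleR_left_diff_distrib)
qed

lemma lattice_basis_subset:
  assumes "lattice_basis C L"
  shows "C \<subseteq> L"
proof
  fix a assume "a \<in> C"
  have "(\<Sum>b\<in>C. of_int (if b = a then 1 else 0) *\<^sub>R b) = (\<Sum>b\<in>C. if b = a then a else 0)"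
    by (intro sum.cong) auto
  also have "\<dots> = a"
    using assms \<open>a \<in> C\<close> by (simp add: lattice_basis_def)
  finally show "a \<in> L"
    unfolding lattice_mem_iff[OF assms] by (intro exI[of _ "\<lambda>b. if b = a then 1 else 0"]) simp
qed

lemma sum_scale_in_span: "(\<Sum>b\<in>C. c b *\<^sub>R b) \<in> span C"
  by (rule span_sum, rule span_scale, rule span_base)

lemma lattice_subset_span:
  assumes "lattice_basis C L"
  shows "L \<subseteq> span C"
  by (auto simp: lattice_mem_iff[OF assms] sum_scale_in_span)

text \<open>Gram-Schmidt with denominators cleared: multiplying the orthogonalised vector by the
  product of the earlier norms brings it into \<open>L\<close>, and a further factor 2 makes its
  norm a multiple of 4, in particular even.\<close>

lemma exists_orthogonal_even_frame:
  assumes "zmodule L" and int: "\<And>x y. x \<in> L \<Longrightarrow> y \<in> L \<Longrightarrow> x \<bullet> y \<in> \<int>"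
    and "finite C" "C \<subseteq> L"
  obtains B where "B \<subseteq> L" "pairwise orthogonal B" "0 \<notin> B" "span B = span C"
    "\<And>b. b \<in> B \<Longrightarrow> b \<bullet> b / 2 \<in> \<int>"
proof -
  interpret zmodule L by fact
  have "\<exists>B. B \<subseteq> L \<and> pairwise orthogonal B \<and> 0 \<notin> B \<and> span B = span C \<and> (\<forall>b\<in>B. b \<bullet> b / 2 \<in> \<int>)"
    using assms(3,4)
  proof (induction C rule: finite_induct)
    case empty
    show ?case by (intro exI[of _ "{}"]) auto
  next
    case (insert a C)
    then obtain B where B: "B \<subseteq> L" "pairwise orthogonal B" "0 \<notin> B" "span B = span C"
      "\<And>b. b \<in> B \<Longrightarrow> b \<bullet> b / 2 \<in> \<int>" by auto
    have fin: "finite B" using B pairwise_orthogonal_imp_finite by blast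
    define v where "v = a - (\<Sum>b\<in>B. (b \<bullet> a / (b \<bullet> b)) *\<^sub>R b)"
    define q where "q = 2 * (\<Prod>b\<in>B. b \<bullet> b)"
    have "q \<noteq> 0" using fin B(3) by (auto simp: q_def)
    have half: "(q / 2) *\<^sub>R v \<in> L"
    proof -
      have "(q / 2) * (b \<bullet> a / (b \<bullet> b)) \<in> \<int>" if "b \<in> B" for b
      proof -
        have "b \<bullet> b \<noteq> 0" using that B by auto
        then have "(q / 2) * (b \<bullet> a / (b \<bullet> b)) = (\<Prod>b\<in>B - {b}. b \<bullet> b) * (b \<bullet> a)"
          using fin that by (simp add: q_def prod.remove)
        also have "\<dots> \<in> \<int>"
          using that B insert.prems by (intro Ints_mult Ints_prod int) auto
        finally show ?thesis .
      qed
      moreover have "q / 2 \<in> \<int>"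
        using B by (auto simp: q_def intro!: Ints_prod int)
      moreover have "(q / 2) *\<^sub>R v = (q / 2) *\<^sub>R a - (\<Sum>b\<in>B. ((q / 2) * (b \<bullet> a / (b \<bullet> b))) *\<^sub>R b)"
        by (simp add: v_def scaleR_diff_right scaleR_sum_right)
      ultimately show ?thesis
        using insert.prems B by (auto intro!: diff sum scale_Ints)
    qed
    have span_v: "span (insert (q *\<^sub>R v) B) = span (insert a C)"
    proof -
      define s where "s = (\<Sum>b\<in>B. (b \<bullet> a / (b \<bullet> b)) *\<^sub>R b)"
      have s: "s \<in> span (insert x B)" for x
        unfolding s_def by (rule subsetD[OF span_mono[OF subset_insertI] sum_scale_in_span])
      have "q *\<^sub>R (a - s) \<in> span (insert a B)"
        by (intro span_scale span_diff s) (simp add: span_base)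
      then have 1: "q *\<^sub>R v \<in> span (insert a B)" by (simp add: v_def s_def)
      have "(1 / q) *\<^sub>R (q *\<^sub>R v) + s \<in> span (insert (q *\<^sub>R v) B)"
        by (rule span_add[OF span_scale[OF span_base] s]) simp
      then have 2: "a \<in> span (insert (q *\<^sub>R v) B)"
        using \<open>q \<noteq> 0\<close> by (simp add: v_def s_def)
      have "span (insert (q *\<^sub>R v) B) = span (insert a B)"
        unfolding span_eq using 1 2 by (auto simp: span_base)
      also have "\<dots> = span (insert a C)"
        using B(4) by (simp add: span_insert)
      finally show ?thesis .
    qed
    show ?case
    \<comment> \<open>If \<open>v = 0\<close>, then \<open>a\<close> already lies in the span of
      \<open>B\<close>, and \<open>B\<close> is kept so that it stays free of 0.\<close>
    proof (cases "v = 0")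
      case True
      then have "span B = span (insert a C)"
        using span_v by (metis scaleR_zero_right span_insert_0)
      then show ?thesis using B by (intro exI[of _ B]) auto
    next
      case False
      have "(q *\<^sub>R v) \<bullet> (q *\<^sub>R v) / 2 = 2 * (((q / 2) *\<^sub>R v) \<bullet> ((q / 2) *\<^sub>R v))"
        by (simp add: field_simps)
      then have "(q *\<^sub>R v) \<bullet> (q *\<^sub>R v) / 2 \<in> \<int>"
        using half int by (metis Ints_mult Ints_numeral)
      moreover have "q *\<^sub>R v \<in> L"
        using scale_int[OF half, of 2] by simp
      moreover have "orthogonal (q *\<^sub>R v) b" if "b \<in> B" for b
        using Gram_Schmidt_step[OF B(2) span_base[OF that], of a]
        by (simp add: v_def[symmetric] orthogonal_commute orthogonal_clauses)
      then have "pairwise orthogonal (insert (q *\<^sub>R v) B)"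
        using B(2) by (auto simp: pairwise_insert orthogonal_commute)
      ultimately show ?thesis
        using B span_v False \<open>q \<noteq> 0\<close>
        by (intro exI[of _ "insert (q *\<^sub>R v) B"]) auto
    qed
  qed
  then show ?thesis using that by blast
qed

text \<open>
  \<open>B\<close> generates an even lattice \<open>M\<close>. Below, \<open>dual\<close> is the dual of \<open>M\<close>, \<open>cell\<close> is a set of representatives of
  \<open>dual\<close> modulo \<open>M\<close>, and \<open>reduce\<close> is the reduction to these representatives.
\<close>

locale even_frame =
  fixes B :: "'a::euclidean_space set"
  assumes orth: "pairwise orthogonal B" and nz: "0 \<notin> B"
    and even: "b \<in> B \<Longrightarrow> b \<bullet> b / 2 \<in> \<int>"
begin

definition dual :: "'a set" where
  "dual = {x \<in> span B. \<forall>b\<in>B. x \<bullet> b \<in> \<int>}"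

definition cell :: "'a set" where
  "cell = {x \<in> dual. \<forall>b\<in>B. 0 \<le> x \<bullet> b \<and> x \<bullet> b < b \<bullet> b}"

definition shift :: "'a \<Rightarrow> 'a" where
  "shift x = (\<Sum>b\<in>B. of_int \<lfloor>(x \<bullet> b) / (b \<bullet> b)\<rfloor> *\<^sub>R b)"

definition reduce :: "'a \<Rightarrow> 'a" where
  "reduce x = x - shift x"

section \<open>Coordinates and reduction with respect to the frame\<close>

lemma finite_frame: "finite B"
  using orth pairwise_orthogonal_imp_finite by blast

lemma norm_pos: "b \<in> B \<Longrightarrow> b \<bullet> b > 0"
  using nz by auto

lemma norm_Ints: "b \<in> B \<Longrightarrow> b \<bullet> b \<in> \<int>"
  using Ints_mult[OF even, of b 2] by simp

lemma inner_comb: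
  assumes "a \<in> B"
  shows "(\<Sum>b\<in>B. c b *\<^sub>R b) \<bullet> a = c a * (a \<bullet> a)"
proof -
  have "(\<Sum>b\<in>B. c b *\<^sub>R b) \<bullet> a = (\<Sum>b\<in>B. if b = a then c a * (a \<bullet> a) else 0)"
    unfolding inner_sum_left using orth assms
    by (intro sum.cong) (auto simp: pairwise_def orthogonal_def)
  then show ?thesis using assms finite_frame by simp
qed

lemma expand:
  assumes "x \<in> span B"
  shows "x = (\<Sum>b\<in>B. (x \<bullet> b / (b \<bullet> b)) *\<^sub>R b)"
proof -
  define y where "y = x - (\<Sum>b\<in>B. (b \<bullet> x / (b \<bullet> b)) *\<^sub>R b)"
  have "y \<in> span B"
    unfolding y_def using assms by (rule span_diff[OF _ sum_scale_in_span])
  then have "orthogonal y y"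
    using Gram_Schmidt_step[OF orth, of y x] by (simp add: y_def)
  then show ?thesis
    by (simp add: orthogonal_self y_def inner_commute)
qed

lemma span_eqI:
  assumes "x \<in> span B" "y \<in> span B" "\<And>b. b \<in> B \<Longrightarrow> x \<bullet> b = y \<bullet> b"
  shows "x = y"
proof -
  have "x = (\<Sum>b\<in>B. (x \<bullet> b / (b \<bullet> b)) *\<^sub>R b)" by (rule expand) fact
  also have "\<dots> = (\<Sum>b\<in>B. (y \<bullet> b / (b \<bullet> b)) *\<^sub>R b)"
    by (intro sum.cong refl) (simp add: assms)
  also have "\<dots> = y" by (rule expand[symmetric]) fact
  finally show ?thesis .
qed

lemma parseval:
  assumes "x \<in> span B"
  shows "x \<bullet> x = (\<Sum>b\<in>B. (x \<bullet> b)\<^sup>2 / (b \<bullet> b))"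
proof -
  have "x \<bullet> x = x \<bullet> (\<Sum>b\<in>B. (x \<bullet> b / (b \<bullet> b)) *\<^sub>R b)"
    using expand[OF assms] by simp
  then show ?thesis by (simp add: inner_sum_right power2_eq_square)
qed

lemma zmodule_dual: "zmodule dual"
  by unfold_locales (auto simp: dual_def inner_diff_left span_diff span_zero)

lemma frame_subset_dual: "B \<subseteq> dual"
proof
  fix a assume a: "a \<in> B"
  have "a \<bullet> b \<in> \<int>" if "b \<in> B" for b
    using orth a that norm_Ints[of a] by (cases "a = b") (auto simp: pairwise_def orthogonal_def)
  then show "a \<in> dual" using a by (simp add: dual_def span_base)
qed

lemma inner_shift_left: "b \<in> B \<Longrightarrow> shift x \<bullet> b = of_int \<lfloor>(x \<bullet> b) / (b \<bullet> b)\<rfloor> * (b \<bullet> b)"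
  unfolding shift_def by (rule inner_comb)

lemma shift_mem:
  assumes "zmodule K" "B \<subseteq> K"
  shows "shift x \<in> K"
proof -
  interpret zmodule K by fact
  show ?thesis using assms(2) by (auto simp: shift_def intro!: sum scale_int)
qed

lemma reduce_mem:
  assumes "zmodule K" "B \<subseteq> K" "x \<in> K"
  shows "reduce x \<in> K"
  unfolding reduce_def by (intro zmodule.diff assms shift_mem)

lemma inner_shift_Ints: "x \<in> dual \<Longrightarrow> x \<bullet> shift y \<in> \<int>"
  by (auto simp: shift_def inner_sum_right dual_def intro!: Ints_sum Ints_mult)

text \<open>Orthogonality leaves only the diagonal terms, each an integer square times an even
  norm.\<close>

lemma shift_shift_even: "(shift y \<bullet> shift y) / 2 \<in> \<int>"
proof -
  have "shift y \<bullet> shift y / 2 = (\<Sum>b\<in>B. of_int \<lfloor>(y \<bullet> b) / (b \<bullet> b)\<rfloor> * (of_int \<lfloor>(y \<bullet> b) / (b \<bullet> b)\<rfloor> * (b \<bullet> b / 2)))"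
    by (subst (2) shift_def) (simp add: inner_sum_right inner_shift_left sum_divide_distrib)
  also have "\<dots> \<in> \<int>" by (intro Ints_sum Ints_mult even Ints_of_int)
  finally show ?thesis .
qed

lemma reduce_cell:
  assumes "x \<in> dual"
  shows "reduce x \<in> cell"
proof -
  have "reduce x \<in> dual"
    by (intro reduce_mem zmodule_dual frame_subset_dual assms)
  moreover have "0 \<le> reduce x \<bullet> b \<and> reduce x \<bullet> b < b \<bullet> b" if "b \<in> B" for b
  proof -
    have "reduce x \<bullet> b = frac ((x \<bullet> b) / (b \<bullet> b)) * (b \<bullet> b)"
      using norm_pos[OF that]
      by (simp add: reduce_def inner_diff_left inner_shift_left that frac_def left_diff_distrib)
    then show ?thesis
      using norm_pos[OF that] frac_ge_0 frac_lt_1 by (metis mult_nonneg_nonneg less_imp_le mult_less_cancel_right2 not_less)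
  qed
  ultimately show ?thesis by (simp add: cell_def)
qed

text \<open>A point of the span is determined by its products with the frame vectors. By
  orthogonality these can be prescribed independently, so in \<open>cell\<close> they are arbitrary
  integers from 0 to \<open>b \<bullet> b - 1\<close>; sums over \<open>cell\<close> thereby become
  iterated sums.\<close>

lemma bij_cell:
  "bij_betw (\<lambda>x. \<lambda>b\<in>B. nat \<lfloor>x \<bullet> b\<rfloor>) cell (PiE B (\<lambda>b. {..<nat \<lfloor>b \<bullet> b\<rfloor>}))"
proof (rule bij_betw_byWitness[where f' = "\<lambda>g. \<Sum>b\<in>B. (real (g b) / (b \<bullet> b)) *\<^sub>R b"])
  have coord: "real (nat \<lfloor>x \<bullet> b\<rfloor>) = x \<bullet> b" if "x \<in> cell" "b \<in> B" for x b
    using that by (auto simp: cell_def dual_def elim!: Ints_cases)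
  show "\<forall>x\<in>cell. (\<Sum>b\<in>B. (real ((\<lambda>b\<in>B. nat \<lfloor>x \<bullet> b\<rfloor>) b) / (b \<bullet> b)) *\<^sub>R b) = x"
  proof
    fix x assume x: "x \<in> cell"
    then have "x \<in> span B" by (simp add: cell_def dual_def)
    have "(\<Sum>b\<in>B. (real ((\<lambda>b\<in>B. nat \<lfloor>x \<bullet> b\<rfloor>) b) / (b \<bullet> b)) *\<^sub>R b) = (\<Sum>b\<in>B. (x \<bullet> b / (b \<bullet> b)) *\<^sub>R b)"
      by (intro sum.cong refl) (simp add: coord x)
    then show "(\<Sum>b\<in>B. (real ((\<lambda>b\<in>B. nat \<lfloor>x \<bullet> b\<rfloor>) b) / (b \<bullet> b)) *\<^sub>R b) = x"
      using expand[OF \<open>x \<in> span B\<close>] by simp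
  qed
  have inn: "(\<Sum>b\<in>B. (real (g b) / (b \<bullet> b)) *\<^sub>R b) \<bullet> a = real (g a)" if "a \<in> B" for g :: "'a \<Rightarrow> nat" and a
    using inner_comb[OF that, of "\<lambda>b. real (g b) / (b \<bullet> b)"] norm_pos[OF that] by simp
  show "\<forall>g\<in>PiE B (\<lambda>b. {..<nat \<lfloor>b \<bullet> b\<rfloor>}). (\<lambda>b\<in>B. nat \<lfloor>(\<Sum>b\<in>B. (real (g b) / (b \<bullet> b)) *\<^sub>R b) \<bullet> b\<rfloor>) = g"
    by (auto simp: inn PiE_def extensional_def fun_eq_iff)
  show "(\<lambda>x. \<lambda>b\<in>B. nat \<lfloor>x \<bullet> b\<rfloor>) ` cell \<subseteq> PiE B (\<lambda>b. {..<nat \<lfloor>b \<bullet> b\<rfloor>})"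
  proof (intro image_subsetI PiE_I)
    fix x b assume xb: "x \<in> cell" "b \<in> B"
    then have "real (nat \<lfloor>x \<bullet> b\<rfloor>) < b \<bullet> b" by (simp add: coord) (simp add: cell_def)
    then have "nat \<lfloor>x \<bullet> b\<rfloor> < nat \<lfloor>b \<bullet> b\<rfloor>"
      using norm_Ints[OF xb(2)] by (auto elim!: Ints_cases)
    then show "(\<lambda>b\<in>B. nat \<lfloor>x \<bullet> b\<rfloor>) b \<in> {..<nat \<lfloor>b \<bullet> b\<rfloor>}"
      using xb by simp
  qed simp
  show "(\<lambda>g. \<Sum>b\<in>B. (real (g b) / (b \<bullet> b)) *\<^sub>R b) ` PiE B (\<lambda>b. {..<nat \<lfloor>b \<bullet> b\<rfloor>}) \<subseteq> cell"
  proof (intro image_subsetI)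
    fix g assume g: "g \<in> PiE B (\<lambda>b. {..<nat \<lfloor>b \<bullet> b\<rfloor>})"
    have "real (g b) < b \<bullet> b" if "b \<in> B" for b
    proof -
      have "g b < nat \<lfloor>b \<bullet> b\<rfloor>" using g that by auto
      then show ?thesis using norm_Ints[OF that] by (auto elim!: Ints_cases)
    qed
    then show "(\<Sum>b\<in>B. (real (g b) / (b \<bullet> b)) *\<^sub>R b) \<in> cell"
      by (auto simp: cell_def dual_def inn sum_scale_in_span)
  qed
qed

section \<open>Gauss sums over the discriminant group\<close>

lemma finite_cell: "finite cell"
  using bij_betw_finite[OF bij_cell] finite_frame by (simp add: finite_PiE)

text \<open>\<open>K \<inter> cell\<close> represents \<open>K\<close> modulo the lattice generated
  by \<open>B\<close>, and translation by \<open>z\<close> permutes these classes. On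
  representatives the permutation is \<open>\<phi>\<close>; by finiteness its injectivity
  suffices.\<close>

lemma sum_translate:
  fixes p :: "'a \<Rightarrow> complex"
  assumes K: "zmodule K" "B \<subseteq> K" "K \<subseteq> dual" and z: "z \<in> K"
    and per: "\<And>x. x \<in> K \<Longrightarrow> p (reduce x) = p x"
  shows "(\<Sum>x\<in>K \<inter> cell. p (x + z)) = (\<Sum>x\<in>K \<inter> cell. p x)"
proof -
  interpret zmodule K by fact
  define \<phi> where "\<phi> x = reduce (x + z)" for x
  have sub: "\<phi> ` (K \<inter> cell) \<subseteq> K \<inter> cell"
    using K z by (auto simp: \<phi>_def intro!: reduce_mem reduce_cell add)
  have inj: "inj_on \<phi> (K \<inter> cell)"
  proof (rule inj_onI)
    fix x y assume x: "x \<in> K \<inter> cell" and y: "y \<in> K \<inter> cell" and eq: "\<phi> x = \<phi> y"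
    show "x = y"
    proof (rule span_eqI)
      show "x \<in> span B" "y \<in> span B" using x y by (auto simp: cell_def dual_def)
      fix b assume b: "b \<in> B"
      \<comment> \<open>\<open>x - y\<close> is an integral combination of \<open>B\<close>, so its
        product with \<open>b\<close> is \<open>n\<close> times \<open>b \<bullet> b\<close>; two
        points of \<open>cell\<close> differ there by less than \<open>b \<bullet> b\<close>, which
        forces \<open>n = 0\<close>.\<close>
      define n where "n = \<lfloor>((x + z) \<bullet> b) / (b \<bullet> b)\<rfloor> - \<lfloor>((y + z) \<bullet> b) / (b \<bullet> b)\<rfloor>"
      have "x - y = shift (x + z) - shift (y + z)"
        using eq by (simp add: \<phi>_def reduce_def algebra_simps)
      then have "x \<bullet> b - y \<bullet> b = of_int n * (b \<bullet> b)"
        by (metis inner_diff_left inner_shift_left[OF b] left_diff_distrib n_def of_int_diff)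
      moreover have "\<bar>x \<bullet> b - y \<bullet> b\<bar> < b \<bullet> b"
        using x y b by (force simp: cell_def)
      ultimately have "\<bar>of_int n :: real\<bar> * (b \<bullet> b) < 1 * (b \<bullet> b)"
        using norm_pos[OF b] by (simp add: abs_mult)
      then have "n = 0"
        using norm_pos[OF b] by (subst (asm) mult_less_cancel_right) auto
      then show "x \<bullet> b = y \<bullet> b"
        using \<open>x \<bullet> b - y \<bullet> b = of_int n * (b \<bullet> b)\<close> by simp
    qed
  qed
  have im: "\<phi> ` (K \<inter> cell) = K \<inter> cell"
    using finite_cell sub inj by (intro endo_inj_surj) auto
  have "(\<Sum>x\<in>K \<inter> cell. p (x + z)) = (\<Sum>x\<in>K \<inter> cell. p (\<phi> x))"
    using per z by (intro sum.cong) (auto simp: \<phi>_def add)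
  also have "\<dots> = (\<Sum>x\<in>\<phi> ` (K \<inter> cell). p x)"
    by (simp add: sum.reindex[OF inj])
  finally show ?thesis by (simp add: im)
qed

text \<open>By \<open>parseval\<close> the summand factors over the frame, and
  \<open>bij_cell\<close> turns the sum of products into a product of one-dimensional Gauss sums,
  each contributing a phase of \<open>pi / 4\<close>.\<close>

lemma sum_cell_gauss:
  "(\<Sum>x\<in>cell. cis (pi * (x \<bullet> x))) = (\<Prod>b\<in>B. sqrt (b \<bullet> b)) * cis (real (card B) * pi / 4)"
proof -
  define N where "N b = nat \<lfloor>b \<bullet> b\<rfloor>" for b :: 'a
  have N: "real (N b) = b \<bullet> b" if "b \<in> B" for b
    using norm_Ints[OF that] norm_pos[OF that] by (auto simp: N_def elim!: Ints_cases)
  have evenN: "even (N b)" "N b > 0" if "b \<in> B" for b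
  proof -
    from even[OF that] obtain k :: int where "b \<bullet> b / 2 = of_int k" by (rule Ints_cases)
    then have "real_of_int (int (N b)) = of_int (2 * k)" using N[OF that] by simp
    then have "int (N b) = 2 * k" by (simp only: of_int_eq_iff)
    then show "even (N b)" by presburger
    show "N b > 0" using N[OF that] norm_pos[OF that] by (metis of_nat_0_less_iff)
  qed
  have "(\<Sum>x\<in>cell. cis (pi * (x \<bullet> x))) = (\<Sum>x\<in>cell. \<Prod>b\<in>B. cis (pi * (real ((\<lambda>b\<in>B. nat \<lfloor>x \<bullet> b\<rfloor>) b))\<^sup>2 / real (N b)))"
  proof (intro sum.cong refl)
    fix x assume x: "x \<in> cell"
    have "x \<bullet> b = real (nat \<lfloor>x \<bullet> b\<rfloor>)" if "b \<in> B" for b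
    proof -
      have "x \<bullet> b \<in> \<int>" "x \<bullet> b \<ge> 0" using x that by (auto simp: cell_def dual_def)
      then show ?thesis by (auto elim!: Ints_cases)
    qed
    moreover have "cis (pi * (x \<bullet> x)) = (\<Prod>b\<in>B. cis (pi * (x \<bullet> b)\<^sup>2 / (b \<bullet> b)))"
      using x parseval[of x]
      by (simp add: cell_def dual_def sum_distrib_left cis_sum[OF finite_frame])
    ultimately show "cis (pi * (x \<bullet> x)) = (\<Prod>b\<in>B. cis (pi * (real ((\<lambda>b\<in>B. nat \<lfloor>x \<bullet> b\<rfloor>) b))\<^sup>2 / real (N b)))"
      by (simp add: N cong: prod.cong)
  qed
  also have "\<dots> = (\<Sum>g\<in>PiE B (\<lambda>b. {..<N b}). \<Prod>b\<in>B. cis (pi * (real (g b))\<^sup>2 / real (N b)))"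
    using sum.reindex_bij_betw[OF bij_cell, of "\<lambda>g. \<Prod>b\<in>B. cis (pi * (real (g b))\<^sup>2 / real (N b))"]
    by (simp add: N_def)
  also have "\<dots> = (\<Prod>b\<in>B. \<Sum>k<N b. cis (pi * (real k)\<^sup>2 / real (N b)))"
    by (rule prod_sum_PiE[symmetric]) (auto simp: finite_frame)
  also have "\<dots> = (\<Prod>b\<in>B. gauss_sum (N b))"
    by (simp add: gauss_sum_def)
  also have "\<dots> = (\<Prod>b\<in>B. complex_of_real (sqrt (b \<bullet> b)) * cis (pi / 4))"
    by (intro prod.cong refl) (simp add: gauss_sum_eq evenN N)
  finally show ?thesis
    by (simp add: prod.distrib Complex.DeMoivre)
qed

text \<open>
  The Gauss sum \<open>G\<close> of \<open>cis (pi * (x \<bullet> x))\<close> over \<open>dual\<close> modulo \<open>M\<close> is unchanged by the shift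
  \<open>x \<mapsto> x + y + w / 2\<close> for every \<open>y \<in> L\<close>. Averaging over \<open>y\<close> in \<open>L\<close> modulo \<open>M\<close> kills the terms outside
  the dual of \<open>L\<close>, which is \<open>L\<close>, so \<open>G = cis (pi * (w \<bullet> w) / 4) * card H\<close>. The product formula for \<open>G\<close>
  has the phase \<open>cis (pi * card B / 4)\<close>.
\<close>

lemma van_der_Blij:
  assumes L: "zmodule L" "B \<subseteq> L" "L \<subseteq> span B"
    and int: "\<And>x y. x \<in> L \<Longrightarrow> y \<in> L \<Longrightarrow> x \<bullet> y \<in> \<int>"
    and uni: "\<And>y. y \<in> span B \<Longrightarrow> (\<And>x. x \<in> L \<Longrightarrow> x \<bullet> y \<in> \<int>) \<Longrightarrow> y \<in> L"
    and w: "w \<in> L" "\<And>x. x \<in> L \<Longrightarrow> (x \<bullet> x + x \<bullet> w) / 2 \<in> \<int>"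
  shows "\<exists>k::int. w \<bullet> w = real (card B) + 8 * of_int k"
proof -
  interpret zmodule L by fact
  interpret P: zmodule dual by (rule zmodule_dual)
  define f where "f x = cis (pi * (x \<bullet> x))" for x :: 'a
  define g where "g x = cis (pi * (x \<bullet> x + x \<bullet> w))" for x
  define H where "H = L \<inter> cell"
  define G where "G = (\<Sum>x\<in>cell. f x)"
  define \<zeta> where "\<zeta> = cis (pi * (w \<bullet> w) / 4)"
  have Ld: "L \<subseteq> dual" using L int by (auto simp: dual_def)
  have finH: "finite H" using finite_cell by (simp add: H_def)
  have cong: "cis (pi * x) = cis (pi * y)" if "(x - y) / 2 \<in> \<int>" for x y
  proof -
    from that obtain n where "(x - y) / 2 = of_int n" by (rule Ints_cases)
    then have "x = y + 2 * of_int n" by simp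
    then show ?thesis by (rule cis_pi_cong)
  qed
  \<comment> \<open>For \<open>b \<in> B\<close> both \<open>b \<bullet> b\<close> and
    \<open>b \<bullet> b + b \<bullet> w\<close> are even, hence so is
    \<open>b \<bullet> w\<close>.\<close>
  have half_w: "w /\<^sub>R 2 \<in> dual"
  proof -
    have "(w /\<^sub>R 2) \<bullet> b \<in> \<int>" if "b \<in> B" for b
    proof -
      have "(b \<bullet> b + b \<bullet> w) / 2 - b \<bullet> b / 2 \<in> \<int>"
        using that L by (intro Ints_diff w even) auto
      then show ?thesis by (simp add: add_divide_distrib inner_commute)
    qed
    then show ?thesis using w L by (auto simp: dual_def intro: span_scale)
  qed
  have f_reduce: "f (reduce x) = f x" if "x \<in> dual" for x
  proof -
    have "(reduce x \<bullet> reduce x - x \<bullet> x) / 2 = shift x \<bullet> shift x / 2 - x \<bullet> shift x"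
      by (simp add: reduce_def inner_diff inner_commute field_simps)
    also have "\<dots> \<in> \<int>" by (intro Ints_diff shift_shift_even inner_shift_Ints that)
    finally show ?thesis unfolding f_def by (rule cong)
  qed
  have G: "G = \<zeta> * (\<Sum>x\<in>cell. g x * cis (2 * pi * (x \<bullet> y)))" if "y \<in> L" for y
  proof -
    have cell: "dual \<inter> cell = cell" by (auto simp: cell_def)
    have yd: "y + w /\<^sub>R 2 \<in> dual" using that Ld half_w by (auto intro: P.add)
    have "G = (\<Sum>x\<in>cell. f (x + (y + w /\<^sub>R 2)))"
      using sum_translate[where p = f, OF zmodule_dual frame_subset_dual subset_refl yd f_reduce]
      by (simp add: G_def cell)
    also have "\<dots> = (\<Sum>x\<in>cell. \<zeta> * (g x * cis (2 * pi * (x \<bullet> y))))"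
    proof (intro sum.cong refl)
      fix x
      \<comment> \<open>\<open>u\<close> is the norm of \<open>x + y + w / 2\<close> without the
        part \<open>y \<bullet> y + y \<bullet> w\<close>, which is an even integer and so invisible
        to the phase.\<close>
      define u where "u = w \<bullet> w / 4 + (x \<bullet> x + x \<bullet> w) + 2 * (x \<bullet> y)"
      have "((x + (y + w /\<^sub>R 2)) \<bullet> (x + (y + w /\<^sub>R 2)) - u) / 2 = (y \<bullet> y + y \<bullet> w) / 2"
        by (simp add: u_def inner_add inner_commute field_simps)
      also have "\<dots> \<in> \<int>" by (rule w) fact
      finally have "f (x + (y + w /\<^sub>R 2)) = cis (pi * u)"
        unfolding f_def by (rule cong)
      then show "f (x + (y + w /\<^sub>R 2)) = \<zeta> * (g x * cis (2 * pi * (x \<bullet> y)))"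
        by (simp add: \<zeta>_def g_def u_def cis_mult algebra_simps)
    qed
    finally show ?thesis by (simp add: sum_distrib_left)
  qed
  \<comment> \<open>Orthogonality of characters:
    \<open>y \<mapsto> cis (2 * pi * (x \<bullet> y))\<close> is trivial on \<open>L\<close> exactly
    when \<open>x\<close> is in the dual of \<open>L\<close>, that is, in \<open>L\<close>.
    Otherwise translation by some \<open>z\<close> multiplies the sum by a number other than
    1.\<close>
  have inner_sum: "(\<Sum>y\<in>H. cis (2 * pi * (x \<bullet> y))) = (if x \<in> L then of_nat (card H) else 0)"
    if x: "x \<in> cell" for x
  proof (cases "x \<in> L")
    case True
    then show ?thesis using int by (simp add: H_def)
  next
    case False
    have xd: "x \<in> dual" using x by (simp add: cell_def)
    then obtain z where z: "z \<in> L" "x \<bullet> z \<notin> \<int>"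
      using uni[of x] False by (auto simp: dual_def inner_commute)
    have per: "cis (2 * pi * (x \<bullet> reduce y)) = cis (2 * pi * (x \<bullet> y))" for y
      using cong[of "2 * (x \<bullet> reduce y)" "2 * (x \<bullet> y)"] Ints_minus[OF inner_shift_Ints[OF xd, of y]]
      by (simp add: reduce_def inner_diff_right algebra_simps)
    have "(\<Sum>y\<in>H. cis (2 * pi * (x \<bullet> (y + z)))) = (\<Sum>y\<in>H. cis (2 * pi * (x \<bullet> y)))"
      unfolding H_def 
      by (rule sum_translate[where p = "\<lambda>y. cis (2 * pi * (x \<bullet> y))", OF L(1,2) Ld z(1) per])
    moreover have "(\<Sum>y\<in>H. cis (2 * pi * (x \<bullet> (y + z)))) = cis (2 * pi * (x \<bullet> z)) * (\<Sum>y\<in>H. cis (2 * pi * (x \<bullet> y)))"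
      by (simp add: sum_distrib_left cis_mult inner_add_right algebra_simps)
    moreover have "cis (2 * pi * (x \<bullet> z)) \<noteq> 1"
    proof
      assume "cis (2 * pi * (x \<bullet> z)) = 1"
      then obtain n where "2 * pi * (x \<bullet> z) = of_int n * (2 * pi)"
        by (auto simp: cis_eq_1_iff)
      then have "x \<bullet> z = of_int n" by simp
      then show False using z(2) by simp
    qed
    ultimately show ?thesis using False by simp
  qed
  have "of_nat (card H) * G = (\<Sum>y\<in>H. \<zeta> * (\<Sum>x\<in>cell. g x * cis (2 * pi * (x \<bullet> y))))"
  proof -
    have "(\<Sum>y\<in>H. \<zeta> * (\<Sum>x\<in>cell. g x * cis (2 * pi * (x \<bullet> y)))) = (\<Sum>y\<in>H. G)"
      by (intro sum.cong refl G[symmetric]) (simp add: H_def)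
    then show ?thesis by simp
  qed
  also have "\<dots> = \<zeta> * (\<Sum>x\<in>cell. g x * (\<Sum>y\<in>H. cis (2 * pi * (x \<bullet> y))))"
    unfolding sum_distrib_left[symmetric] sum.swap[of _ cell H] by (simp only: sum_distrib_left)
  also have "(\<Sum>x\<in>cell. g x * (\<Sum>y\<in>H. cis (2 * pi * (x \<bullet> y)))) = (\<Sum>x\<in>cell. if x \<in> L then of_nat (card H) else 0)"
  proof (intro sum.cong refl)
    fix x assume x: "x \<in> cell"
    have "g x = 1" if "x \<in> L"
      using cong[of "x \<bullet> x + x \<bullet> w" 0] w(2)[OF that] by (simp add: g_def)
    then show "g x * (\<Sum>y\<in>H. cis (2 * pi * (x \<bullet> y))) = (if x \<in> L then of_nat (card H) else 0)"
      by (simp add: inner_sum[OF x])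
  qed
  also have "\<dots> = of_nat (card H) * of_nat (card H)"
  proof -
    have "cell \<inter> {x. x \<in> L} = H" by (auto simp: H_def)
    then show ?thesis using finite_cell by (simp add: sum.If_cases)
  qed
  finally have eq: "of_nat (card H) * G = of_nat (card H) * (\<zeta> * of_nat (card H))"
    by (simp add: mult_ac)
  have "0 \<in> H"
    using zero norm_pos by (auto simp: H_def cell_def P.zero)
  then have cH: "card H > 0" using finH by (auto simp: card_gt_0_iff)
  define r where "r = (\<Prod>b\<in>B. sqrt (b \<bullet> b))"
  have "r > 0" unfolding r_def using norm_pos by (intro prod_pos) auto
  have GG: "of_real r * cis (real (card B) * pi / 4) = \<zeta> * of_nat (card H)"
    using eq cH sum_cell_gauss by (simp add: G_def f_def r_def)
  \<comment> \<open>Each side is a positive real times a complex number of modulus 1. Absolute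
    values give \<open>r = card H\<close>; the phases then agree, which is the congruence modulo
    8.\<close>
  then have "norm (of_real r * cis (real (card B) * pi / 4)) = norm (\<zeta> * of_nat (card H))"
    by simp
  then have "r = real (card H)"
    using \<open>r > 0\<close> by (simp add: norm_mult \<zeta>_def)
  then have "cis (real (card B) * pi / 4) = \<zeta>"
    using GG cH by simp
  then obtain n where "pi * (w \<bullet> w) / 4 = real (card B) * pi / 4 + of_int n * (2 * pi)"
    unfolding \<zeta>_def cis_eq_iff rcong_altdef by blast
  then have "pi * (w \<bullet> w) = pi * (real (card B) + 8 * of_int n)"
    by (simp add: algebra_simps)
  then show ?thesis by auto
qed

end

section \<open>Isometries and exceptional vectors\<close>

lemma carrier_isometry_group:
  "f \<in> carrier (isometry_group L) \<longleftrightarrow> f \<in> Bij L \<and>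
     (\<forall>x\<in>L. \<forall>y\<in>L. f (x + y) = f x + f y) \<and> (\<forall>x\<in>L. \<forall>y\<in>L. f x \<bullet> f y = x \<bullet> y)"
  by (simp add: isometry_group_def)

lemma subgroup_isometry_group:
  assumes "zmodule L"
  shows "subgroup (carrier (isometry_group L)) (BijGroup L)"
proof -
  interpret zmodule L by fact
  interpret BG: group "BijGroup L" by (rule group_BijGroup)
  have carr: "carrier (BijGroup L) = Bij L" by (simp add: BijGroup_def)
  show ?thesis
  proof (rule BG.subgroupI)
    show "carrier (isometry_group L) \<subseteq> carrier (BijGroup L)"
      by (auto simp: carr carrier_isometry_group)
    have "(\<lambda>x\<in>L. x) \<in> carrier (isometry_group L)"
      by (simp add: carrier_isometry_group id_Bij add)
    then show "carrier (isometry_group L) \<noteq> {}" by blast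
  next
    fix f assume f: "f \<in> carrier (isometry_group L)"
    then have fB: "f \<in> Bij L" by (simp add: carrier_isometry_group)
    define g where "g = inv_into L f"
    have g: "g x \<in> L" "f (g x) = x" if "x \<in> L" for x
      using fB that unfolding g_def
      by (auto simp: Bij_def bij_betw_def inv_into_into f_inv_into_f)
    have gf: "g (f x) = x" if "x \<in> L" for x
      using fB that unfolding g_def by (simp add: Bij_def bij_betw_def)
    have "g (x + y) = g x + g y" if "x \<in> L" "y \<in> L" for x y
      using f g that gf[of "g x + g y"] by (simp add: carrier_isometry_group add)
    moreover have "g x \<bullet> g y = x \<bullet> y" if "x \<in> L" "y \<in> L" for x y
      using f g that by (metis carrier_isometry_group)
    ultimately have "(\<lambda>x\<in>L. g x) \<in> carrier (isometry_group L)"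
      using restrict_inv_into_Bij[OF fB] by (simp add: carrier_isometry_group add g_def)
    then show "inv\<^bsub>BijGroup L\<^esub> f \<in> carrier (isometry_group L)"
      using inv_BijGroup[OF fB] by (simp add: g_def)
  next
    fix f g assume f: "f \<in> carrier (isometry_group L)" and g: "g \<in> carrier (isometry_group L)"
    then have fB: "f \<in> Bij L" and gB: "g \<in> Bij L" by (auto simp: carrier_isometry_group)
    have "g x \<in> L" if "x \<in> L" for x using Bij_imp_funcset[OF gB] that by auto
    then have "compose L f g \<in> carrier (isometry_group L)"
      using f g compose_Bij[OF fB gB] by (simp add: carrier_isometry_group compose_def add)
    then show "f \<otimes>\<^bsub>BijGroup L\<^esub> g \<in> carrier (isometry_group L)"
      using fB gB by (simp add: BijGroup_def)
  qed
qed

lemma group_isometry_group: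
  assumes "zmodule L"
  shows "group (isometry_group L)"
proof -
  have "isometry_group L = (BijGroup L)\<lparr>carrier := carrier (isometry_group L)\<rparr>"
    by (simp add: isometry_group_def)
  then show ?thesis
    using subgroup.subgroup_is_group[OF subgroup_isometry_group[OF assms] group_BijGroup] by simp
qed

lemma Exc_isometry_iff:
  assumes "unimodular L" "f \<in> carrier (isometry_group L)" "x \<in> L"
  shows "f x \<in> Exc L \<longleftrightarrow> x \<in> Exc L"
proof -
  have f: "f ` L = L" "\<And>x y. x \<in> L \<Longrightarrow> y \<in> L \<Longrightarrow> f x \<bullet> f y = x \<bullet> y"
    using assms(2) by (auto simp: carrier_isometry_group Bij_def bij_betw_def)
  \<comment> \<open>The test vectors are rewritten as images under \<open>f\<close>, so that
    invariance of the form applies to both sides of the congruence.\<close>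
  have "(\<forall>y\<in>L. [y \<bullet> f x = y \<bullet> y] (rmod 2)) \<longleftrightarrow> (\<forall>y\<in>f ` L. [y \<bullet> f x = y \<bullet> y] (rmod 2))"
    by (simp add: f(1))
  also have "\<dots> \<longleftrightarrow> (\<forall>y\<in>L. [y \<bullet> x = y \<bullet> y] (rmod 2))"
    using assms(3) by (simp add: f(2))
  finally show ?thesis
    using assms f(1) by (auto simp: Exc_def characteristic_vectors_def unimodular_def f(2))
qed

lemma Exc_subset:
  assumes "unimodular L"
  shows "Exc L \<subseteq> L"
  using assms by (auto simp: Exc_def characteristic_vectors_def unimodular_def)

lemma Exc_action_Bij:
  assumes "unimodular L" "f \<in> carrier (isometry_group L)"
  shows "Exc_action L f \<in> Bij (Exc L)"
proof -
  have f: "inj_on f L" "f ` L = L"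
    using assms(2) by (auto simp: carrier_isometry_group Bij_def bij_betw_def)
  have "f ` Exc L = Exc L"
  proof
    show "f ` Exc L \<subseteq> Exc L"
      using Exc_isometry_iff[OF assms] Exc_subset[OF assms(1)] by blast
    show "Exc L \<subseteq> f ` Exc L"
    proof
      fix x assume x: "x \<in> Exc L"
      then obtain y where "y \<in> L" "x = f y" using f(2) Exc_subset[OF assms(1)] by blast
      then show "x \<in> f ` Exc L" using x Exc_isometry_iff[OF assms] by blast
    qed
  qed
  moreover have "inj_on f (Exc L)"
    using f(1) Exc_subset[OF assms(1)] by (rule inj_on_subset)
  ultimately show ?thesis
    by (simp add: Exc_action_def Bij_def bij_betw_def)
qed

lemma group_action_Exc:
  assumes "zmodule L" "unimodular L"
  shows "group_action (isometry_group L) (Exc L) (Exc_action L)"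
proof -
  have carr: "carrier (BijGroup (Exc L)) = Bij (Exc L)" by (simp add: BijGroup_def)
  have "Exc_action L (f \<otimes>\<^bsub>isometry_group L\<^esub> g) = Exc_action L f \<otimes>\<^bsub>BijGroup (Exc L)\<^esub> Exc_action L g"
    if f: "f \<in> carrier (isometry_group L)" and g: "g \<in> carrier (isometry_group L)" for f g
  proof -
    have "f \<otimes>\<^bsub>isometry_group L\<^esub> g = compose L f g"
      using f g by (simp add: isometry_group_def BijGroup_def)
    moreover have "Exc_action L f \<otimes>\<^bsub>BijGroup (Exc L)\<^esub> Exc_action L g
        = compose (Exc L) (Exc_action L f) (Exc_action L g)"
      using Exc_action_Bij[OF assms(2) f] Exc_action_Bij[OF assms(2) g] by (simp add: BijGroup_def)
    moreover have "g x \<in> Exc L" "x \<in> L" if "x \<in> Exc L" for x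
      using that Exc_isometry_iff[OF assms(2) g] Exc_subset[OF assms(2)] by auto
    ultimately show ?thesis
      by (auto simp: Exc_action_def compose_def restrict_def fun_eq_iff)
  qed
  then show ?thesis
    using group_isometry_group[OF assms(1)] group_BijGroup[of "Exc L"] Exc_action_Bij[OF assms(2)]
    by (simp add: group_action_def group_hom_def group_hom_axioms_def hom_def carr)
qed

text \<open>For \<open>v = 0\<close> the division by \<open>v \<bullet> v\<close> yields \<open>0\<close>, and the map in the proof is \<open>\<epsilon>\<close> times the identity.\<close>

lemma signed_reflection:
  assumes "zmodule L" and int: "\<And>x y. x \<in> L \<Longrightarrow> y \<in> L \<Longrightarrow> x \<bullet> y \<in> \<int>"
    and "u \<in> L" "v \<in> L" "u \<bullet> v = 0" "v \<bullet> v \<le> 2" "\<epsilon> = 1 \<or> \<epsilon> = -1"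
  shows "\<exists>f\<in>carrier (isometry_group L). f (u + v) = \<epsilon> *\<^sub>R (u - v)"
proof -
  interpret zmodule L by fact
  define s where "s x = \<epsilon> *\<^sub>R (x - (2 * (x \<bullet> v) / (v \<bullet> v)) *\<^sub>R v)" for x
  obtain m :: int where m: "v \<bullet> v = of_int m"
    using int[OF assms(4,4)] by (auto elim: Ints_cases)
  have "0 \<le> m" "m \<le> 2"
    using assms(6) inner_ge_zero[of v] unfolding m by simp_all
  then have "m = 0 \<or> m = 1 \<or> m = 2" by presburger
  \<comment> \<open>The bound 2 on the norm enters here: for norm 1 or 2 the quotient
    \<open>2 / (v \<bullet> v)\<close> is an integer, so the reflection preserves
    \<open>L\<close>.\<close>
  then have coeff: "2 * (x \<bullet> v) / (v \<bullet> v) \<in> \<int>" if "x \<in> L" for x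
    using int[OF that assms(4)] m by auto
  have mem: "s x \<in> L" if "x \<in> L" for x
  proof -
    have "x - (2 * (x \<bullet> v) / (v \<bullet> v)) *\<^sub>R v \<in> L"
      by (intro diff scale_Ints coeff that assms)
    from this uminus[OF this] show ?thesis using assms(7) by (auto simp: s_def)
  qed
  have eps: "\<epsilon> * \<epsilon> = 1" using assms(7) by auto
  have "s x \<bullet> v = - \<epsilon> * (x \<bullet> v)" for x
    by (cases "v = 0") (simp_all add: s_def inner_diff_left algebra_simps)
  then have "s (s x) = (\<epsilon> * \<epsilon>) *\<^sub>R x" for x
    by (cases "v = 0") (simp_all add: s_def[of "s x"], simp_all add: s_def algebra_simps)
  then have invol: "s (s x) = x" for x by (simp add: eps)
  have add_s: "s (x + y) = s x + s y" for x y
    by (simp add: s_def inner_add_left add_divide_distrib distrib_left scaleR_left_distrib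
        scaleR_right_distrib scaleR_diff_right)
  have "s x \<bullet> s y = (\<epsilon> * \<epsilon>) * (x \<bullet> y)" for x y
    by (cases "v = 0") (simp_all add: s_def inner_diff inner_commute algebra_simps)
  then have inner_s: "s x \<bullet> s y = x \<bullet> y" for x y by (simp add: eps)
  have "bij_betw s L L"
    by (rule bij_betw_byWitness[where f' = s]) (auto simp: invol mem)
  then have "restrict s L \<in> carrier (isometry_group L)"
    by (simp add: carrier_isometry_group Bij_def add add_s inner_s)
  moreover have "restrict s L (u + v) = \<epsilon> *\<^sub>R (u - v)"
    using assms by (cases "v = 0") (simp_all add: add s_def inner_add_left scaleR_2)
  ultimately show ?thesis by blast
qed

section \<open>Norms and differences of characteristic vectors\<close>

lemma characteristic_norm_mod_8:
  fixes L :: "'a::euclidean_space set"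
  assumes "integral_lattice n L" "unimodular L" "\<xi> \<in> characteristic_vectors L"
  shows "\<exists>k::int. \<xi> \<bullet> \<xi> = real n + 8 * of_int k"
proof -
  obtain C where C: "lattice_basis C L" "card C = n"
    and int: "\<And>x y. x \<in> L \<Longrightarrow> y \<in> L \<Longrightarrow> x \<bullet> y \<in> \<int>"
    using assms(1) by (auto simp: integral_lattice_def)
  have Cfin: "finite C" "independent C" using C by (auto simp: lattice_basis_def)
  obtain B where B: "B \<subseteq> L" "pairwise orthogonal B" "0 \<notin> B" "span B = span C"
    "\<And>b. b \<in> B \<Longrightarrow> b \<bullet> b / 2 \<in> \<int>"
    using exists_orthogonal_even_frame[OF zmodule_lattice[OF C(1)] int Cfin(1) lattice_basis_subset[OF C(1)]]
    by metis
  interpret even_frame B by unfold_locales (use B in auto)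
  have "independent B" using B by (simp add: pairwise_orthogonal_independent)
  \<comment> \<open>\<open>B\<close> and \<open>C\<close> are independent with the same span, so the
    frame has as many elements as the lattice has rank, although it may generate a proper
    sublattice.\<close>
  then have "card B = n"
    using B(4) C(2) Cfin by (metis dim_span dim_eq_card_independent)
  have LB: "L \<subseteq> span B" using lattice_subset_span[OF C(1)] B(4) by simp
  have "span L = span B"
    using LB B(1) by (metis span_minimal span_mono span_span subset_antisym subspace_span)
  have \<xi>: "\<xi> \<in> L" "\<And>x. x \<in> L \<Longrightarrow> [x \<bullet> \<xi> = x \<bullet> x] (rmod 2)"
    using assms by (auto simp: characteristic_vectors_def unimodular_def)
  have "\<exists>k::int. \<xi> \<bullet> \<xi> = real (card B) + 8 * of_int k"
  proof (rule van_der_Blij[OF zmodule_lattice[OF C(1)] B(1) LB int _ \<xi>(1)])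
    show "y \<in> L" if "y \<in> span B" "\<And>x. x \<in> L \<Longrightarrow> x \<bullet> y \<in> \<int>" for y
      using assms(2) that \<open>span L = span B\<close> by (auto simp: unimodular_def dual_lattice_def)
    fix x assume x: "x \<in> L"
    \<comment> \<open>The characteristic congruence says that a difference is even; adding twice
      \<open>x \<bullet> \<xi>\<close> gives the evenness of the sum required by
      \<open>van_der_Blij\<close>.\<close>
    obtain k where "x \<bullet> x = x \<bullet> \<xi> + of_int k * 2"
      using \<xi>(2)[OF x] by (auto simp: rcong_altdef)
    then have eq: "(x \<bullet> x + x \<bullet> \<xi>) / 2 = x \<bullet> \<xi> + of_int k" by simp
    show "(x \<bullet> x + x \<bullet> \<xi>) / 2 \<in> \<int>"
      unfolding eq using int[OF x \<xi>(1)] by simp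
  qed
  then show ?thesis by (simp add: \<open>card B = n\<close>)
qed

text \<open>Both vectors pair with each \<open>x \<in> L\<close> to the parity of
  \<open>x \<bullet> x\<close>, so half their difference pairs integrally with \<open>L\<close> and
  lies in the dual, which is \<open>L\<close>.\<close>

lemma half_diff_characteristic:
  assumes "zmodule L" "unimodular L" "\<xi> \<in> characteristic_vectors L" "\<eta> \<in> characteristic_vectors L"
  shows "(\<xi> - \<eta>) /\<^sub>R 2 \<in> L"
proof -
  have "x \<bullet> ((\<xi> - \<eta>) /\<^sub>R 2) \<in> \<int>" if "x \<in> L" for x
  proof -
    have "[x \<bullet> \<eta> = x \<bullet> \<xi>] (rmod 2)"
      using that assms(3,4) unfolding characteristic_vectors_def
      by (blast intro: rcong_trans rcong_sym)
    then obtain k where "x \<bullet> \<xi> = x \<bullet> \<eta> + of_int k * 2" by (auto simp: rcong_altdef)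
    then have "x \<bullet> ((\<xi> - \<eta>) /\<^sub>R 2) = of_int k" by (simp add: inner_diff_right)
    then show ?thesis by simp
  qed
  moreover have "(\<xi> - \<eta>) /\<^sub>R 2 \<in> span L"
    using assms(3,4) by (intro span_scale span_diff) (auto simp: characteristic_vectors_def dual_lattice_def)
  ultimately have "(\<xi> - \<eta>) /\<^sub>R 2 \<in> dual_lattice L" by (simp add: dual_lattice_def)
  then show ?thesis using assms(2) by (simp add: unimodular_def)
qed

lemma Exc_norm:
  assumes "integral_lattice n L" "unimodular L" "\<xi> \<in> Exc L"
  shows "\<xi> \<bullet> \<xi> = real (n mod 8)"
proof -
  have \<xi>: "\<xi> \<in> characteristic_vectors L" "\<xi> \<bullet> \<xi> < 8" using assms(3) by (auto simp: Exc_def)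
  obtain k :: int where k: "\<xi> \<bullet> \<xi> = real n + 8 * of_int k"
    using characteristic_norm_mod_8[OF assms(1,2) \<xi>(1)] by blast
  then have eq: "\<xi> \<bullet> \<xi> = of_int (int n + 8 * k)" by simp
  have "0 \<le> int n + 8 * k" "int n + 8 * k < 8"
    using \<xi>(2) inner_ge_zero[of \<xi>] unfolding eq by linarith+
  then have "int n + 8 * k = int (n mod 8)" by presburger
  then show ?thesis using eq by simp
qed

theorem theoremE:
  fixes L :: "'a::euclidean_space set" and n :: nat
  assumes "integral_lattice n L"
    and "unimodular L"
    and "\<not> [n = 6] (mod 8)" and "\<not> [n = 7] (mod 8)"
    and "Exc L \<noteq> {}"
  shows "transitive_action (isometry_group L) (Exc L) (Exc_action L)"
proof -
  have L: "zmodule L" and int: "\<And>x y. x \<in> L \<Longrightarrow> y \<in> L \<Longrightarrow> x \<bullet> y \<in> \<int>"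
    using assms(1) zmodule_lattice by (auto simp: integral_lattice_def)
  have "\<exists>g\<in>carrier (isometry_group L). Exc_action L g \<xi> = \<eta>"
    if \<xi>: "\<xi> \<in> Exc L" and \<eta>: "\<eta> \<in> Exc L" for \<xi> \<eta>
  proof -
    define v where "v = (\<xi> - \<eta>) /\<^sub>R 2"
    \<comment> \<open>This is \<open>(\<xi> + \<eta>) / 2\<close>, written so that membership in
      \<open>L\<close> follows from that of \<open>\<xi>\<close> and \<open>v\<close>.\<close>
    define u where "u = \<xi> - v"
    have v: "v \<in> L"
      unfolding v_def using half_diff_characteristic[OF L assms(2)] \<xi> \<eta> by (auto simp: Exc_def)
    have u: "u \<in> L"
      unfolding u_def using zmodule.diff[OF L] v \<xi> Exc_subset[OF assms(2)] by blast
    have \<xi>_eq: "\<xi> = u + v" by (simp add: u_def)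
    have "\<eta> = \<xi> - 2 *\<^sub>R v" by (simp add: v_def)
    then have \<eta>_eq: "\<eta> = u - v" by (simp add: \<xi>_eq scaleR_2)
    have norms: "\<xi> \<bullet> \<xi> = real (n mod 8)" "\<eta> \<bullet> \<eta> = real (n mod 8)"
      using Exc_norm[OF assms(1,2)] \<xi> \<eta> by auto
    then have "(u + v) \<bullet> (u + v) = (u - v) \<bullet> (u - v)"
      by (simp add: \<xi>_eq \<eta>_eq)
    then have orth: "u \<bullet> v = 0" "v \<bullet> u = 0"
      by (simp_all add: inner_add inner_diff inner_commute)
    \<comment> \<open>The excluded residues 6 and 7 are exactly those for which \<open>u\<close> and
      \<open>v\<close> could both have norm at least 3.\<close>
    have "n mod 8 \<le> 5"
      using assms(3,4) by (simp add: cong_def)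
    then have sum_le: "u \<bullet> u + v \<bullet> v \<le> 5"
      using norms(1) orth by (simp add: \<xi>_eq inner_add)
    obtain i j :: int where ij: "u \<bullet> u = of_int i" "v \<bullet> v = of_int j"
      using int[OF u u] int[OF v v] by (auto elim!: Ints_cases)
    have "i + j \<le> 5"
      using sum_le unfolding ij by linarith
    then have "j \<le> 2 \<or> i \<le> 2" by linarith
    then have "v \<bullet> v \<le> 2 \<or> u \<bullet> u \<le> 2"
      unfolding ij by linarith
    then have "\<exists>g\<in>carrier (isometry_group L). g \<xi> = \<eta>"
    proof
      assume "v \<bullet> v \<le> 2"
      then show ?thesis
        using signed_reflection[OF L int u v orth(1), of 1] by (simp add: \<xi>_eq \<eta>_eq)
    next
      \<comment> \<open>With \<open>u\<close> and \<open>v\<close> exchanged and sign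
        \<open>-1\<close>, the reflection in \<open>u\<close> sends \<open>v + u\<close> to
        \<open>- (v - u) = u - v\<close>.\<close>
      assume "u \<bullet> u \<le> 2"
      then show ?thesis
        using signed_reflection[OF L int v u orth(2), of "-1"] by (simp add: \<xi>_eq \<eta>_eq add.commute)
    qed
    then show ?thesis using \<xi> by (simp add: Exc_action_def)
  qed
  then show ?thesis
    using group_action_Exc[OF L assms(2)]
    by (simp add: transitive_action_def transitive_action_axioms_def)
qed

end
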